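(* Let $G$ be a weighted graph. (a) If $a$ is a looped vertex of $G$ then $q(G)=\beta(a)\,q(G-a)+\alpha(a)(x-1)\,q(G^{a}-a)$. (b) If $a$ and $b$ are distinct adjacent unlooped vertices of $G$ then \[ q(G)=\beta(a)q(G-a)+\beta(b)q(G^{ab}-b)+\big(\alpha(a)\alpha(b)(x-1)^{2}-\beta(a)\beta(b)\big)q(G^{ab}-a-b). \] (c) If $G$ has no non-loop edges then \[ q(G)=\Big(\prod_{v\ \mathrm{unlooped}}\big(\alpha(v)(y-1)+\beta(v)\big)\Big)\cdot\Big(\prod_{v\ \mathrm{looped}}\big(\alpha(v)(x-1)+\beta(v)\big)\Big). \]
   Context: All graphs are finite and may have loops (at most one per vertex) but no multiple edges. The adjacency matrix of a graph is the symmetric $0/1$ matrix over $GF(2)$ whose diagonal entry at $v$ is $1$ iff $v$ is looped; $r(G)$, $n(G)$ are its rank and nullity over $GF(2)$ (empty graph: $r=n=0$). For $S\subseteq V(G)$, $G[S]$ is the induced subgraph. Let $A$ be a commutative ring with unity containing elements $x,y$. A weighted graph is a graph $G$ with functions $\alpha,\beta:V(G)\to A$, and \[ q(G)=\sum_{S\subseteq V(G)}\Big(\prod_{s\in S}\alpha(s)\Big)\Big(\prod_{v\notin S}\beta(v)\Big)(x-1)^{r(G[S])}(y-1)^{n(G[S])}. \] Graph operations keep vertex weights. Local complement $G^a$: toggle the adjacency $\{u,w\}$ for all neighbors $u,w$ of $a$ distinct from $a$, including $u=w$ (so loops at neighbors of $a$ are toggled). Pivot $G^{ab}$ ($a\ne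 b$): toggle $\{u,w\}$ for all $u,w\notin\{a,b\}$ with $u$ adjacent to $a$, $w$ adjacent to $b$, and either $u$ not adjacent to $b$ or $w$ not adjacent to $a$ (no loops toggled). *)

theory Defs
  imports Complex_Main "HOL-Library.Z2" "HOL-Library.Function_Algebras"
begin

record 'v looped_graph =
  verts :: "'v set"
  adj :: "'v \<Rightarrow> 'v \<Rightarrow> bool"

text \<open>\<open>adj G v v\<close> says that \<open>v\<close> carries a loop. The predicate ignores record extensions,
  so it also applies to weighted graphs.\<close>

definition is_graph :: "('v, 'z) looped_graph_scheme \<Rightarrow> bool" where
  "is_graph G \<longleftrightarrow>
     finite (verts G) \<and>
     (\<forall>u w. adj G u w \<longrightarrow> u \<in> verts G \<and> w \<in> verts G) \<and>
     (\<forall>u w. adj G u w \<longrightarrow> adj G w u)"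

record ('v, 'a) weighted_graph = "'v looped_graph" +
  alpha :: "'v \<Rightarrow> 'a"
  beta :: "'v \<Rightarrow> 'a"

text \<open>The graph operations act on the record scheme, hence keep the vertex weights.\<close>

definition induced :: "('v, 'z) looped_graph_scheme \<Rightarrow> 'v set \<Rightarrow> ('v, 'z) looped_graph_scheme" where
  "induced G S = G\<lparr>verts := verts G \<inter> S, adj := (\<lambda>u w. u \<in> S \<and> w \<in> S \<and> adj G u w)\<rparr>"

definition del_vertex :: "('v, 'z) looped_graph_scheme \<Rightarrow> 'v \<Rightarrow> ('v, 'z) looped_graph_scheme" where
  "del_vertex G a = induced G (verts G - {a})"

definition toggle :: "('v \<Rightarrow> 'v \<Rightarrow> bool) \<Rightarrow> ('v, 'z) looped_graph_scheme \<Rightarrow> ('v, 'z) looped_graph_scheme" where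
  "toggle T G = G\<lparr>adj := (\<lambda>u w. adj G u w \<noteq> T u w)\<rparr>"

definition local_complement :: "('v, 'z) looped_graph_scheme \<Rightarrow> 'v \<Rightarrow> ('v, 'z) looped_graph_scheme" where
  "local_complement G a =
     toggle (\<lambda>u w. u \<noteq> a \<and> w \<noteq> a \<and> adj G u a \<and> adj G w a) G"

text \<open>The pair to be toggled is unordered, so the condition is required of \<open>(u, w)\<close> or of \<open>(w, u)\<close>.\<close>

definition pivot_pair :: "('v, 'z) looped_graph_scheme \<Rightarrow> 'v \<Rightarrow> 'v \<Rightarrow> 'v \<Rightarrow> 'v \<Rightarrow> bool" where
  "pivot_pair G a b u w \<longleftrightarrow>
     u \<notin> {a, b} \<and> w \<notin> {a, b} \<and> adj G u a \<and> adj G w b \<and> (\<not> adj G u b \<or> \<not> adj G w a)"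

definition pivot :: "('v, 'z) looped_graph_scheme \<Rightarrow> 'v \<Rightarrow> 'v \<Rightarrow> ('v, 'z) looped_graph_scheme" where
  "pivot G a b = toggle (\<lambda>u w. pivot_pair G a b u w \<or> pivot_pair G a b w u) G"

text \<open>Vectors over \<open>GF(2)\<close> indexed by the vertices are functions \<open>'v \<Rightarrow> bit\<close> that vanish off
  the vertex set.\<close>

definition gf2_scale :: "bit \<Rightarrow> ('v \<Rightarrow> bit) \<Rightarrow> 'v \<Rightarrow> bit" where
  "gf2_scale c f = (\<lambda>v. c * f v)"

interpretation gf2: vector_space "gf2_scale :: bit \<Rightarrow> ('v \<Rightarrow> bit) \<Rightarrow> 'v \<Rightarrow> bit"
  by unfold_locales (auto simp: gf2_scale_def fun_eq_iff algebra_simps)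

definition adj_matrix :: "('v, 'z) looped_graph_scheme \<Rightarrow> 'v \<Rightarrow> 'v \<Rightarrow> bit" where
  "adj_matrix G u w = of_bool (adj G u w)"

definition graph_rank :: "('v, 'z) looped_graph_scheme \<Rightarrow> nat" where
  "graph_rank G = gf2.dim (gf2.span (adj_matrix G ` verts G))"

definition graph_kernel :: "('v, 'z) looped_graph_scheme \<Rightarrow> ('v \<Rightarrow> bit) set" where
  "graph_kernel G = {f. (\<forall>w. w \<notin> verts G \<longrightarrow> f w = 0) \<and>
     (\<forall>u\<in>verts G. (\<Sum>w\<in>verts G. adj_matrix G u w * f w) = 0)}"

definition graph_nullity :: "('v, 'z) looped_graph_scheme \<Rightarrow> nat" where
  "graph_nullity G = gf2.dim (graph_kernel G)"

text \<open>The sort \<open>{comm_ring, comm_monoid_mult}\<close> is that of commutative rings with unity;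
  unlike \<open>comm_ring_1\<close> it does not require \<open>0 \<noteq> 1\<close>.\<close>

definition interlace_poly ::
  "'a \<Rightarrow> 'a \<Rightarrow> ('v, 'a::{comm_ring, comm_monoid_mult}) weighted_graph \<Rightarrow> 'a" where
  "interlace_poly x y G =
     (\<Sum>S\<in>Pow (verts G).
        (\<Prod>s\<in>S. alpha G s) * (\<Prod>v\<in>verts G - S. beta G v) *
        (x - 1) ^ graph_rank (induced G S) * (y - 1) ^ graph_nullity (induced G S))"

end

theory Submission imports Defs begin

text \<open>Group the subsets \<open>S\<close> by how they meet \<open>{a}\<close> or \<open>{a, b}\<close>. If \<open>a \<in> S\<close> is looped, eliminating
  row and column \<open>a\<close> turns the adjacency matrix of \<open>G[S]\<close> into \<open>(1)\<close> plus that of \<open>G\<^sup>a[S - a]\<close>; if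
  \<open>a, b \<in> S\<close>, eliminating both leaves that of \<open>G\<^sup>a\<^sup>b[S - a - b]\<close>; if \<open>a \<in> S\<close> and \<open>b \<notin> S\<close>, then \<open>G[S]\<close> and
  \<open>G\<^sup>a\<^sup>b[S]\<close> have congruent matrices. A finite space over \<open>GF(2)\<close> has \<open>2\<close> to the power of its dimension
  elements, so nullities are compared by bijections between kernels, and ranks follow by
  rank-nullity, itself a count of the fibres of the matrix map.\<close>

section \<open>GF(2) arithmetic in ring notation, and sums over power sets\<close>

declare add_bit_eq_xor [simp del] mult_bit_eq_and [simp del]

lemma bit_add_eq_0_iff [simp]: "a + b = 0 \<longleftrightarrow> a = b" for a b :: bit
  by (cases a; cases b) (simp_all add: add_bit_eq_xor)

lemma bit_add_self [simp]: "a + a = 0" "a + (a + b) = b" for a b :: bit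
  by (simp_all flip: add.assoc)

lemma sum_Pow_insert:
  fixes F :: "'v set \<Rightarrow> 'a::comm_monoid_add"
  assumes "finite A" "a \<notin> A"
  shows "(\<Sum>S\<in>Pow (insert a A). F S) = (\<Sum>S\<in>Pow A. F S) + (\<Sum>S\<in>Pow A. F (insert a S))"
proof -
  have "(\<Sum>S\<in>Pow (insert a A). F S) = (\<Sum>S\<in>Pow A. F S) + (\<Sum>S\<in>insert a ` Pow A. F S)"
    unfolding Pow_insert using assms by (intro sum.union_disjoint) auto
  moreover have "(\<Sum>S\<in>insert a ` Pow A. F S) = (\<Sum>S\<in>Pow A. F (insert a S))"
    using assms by (subst sum.reindex) (auto simp: inj_on_def)
  ultimately show ?thesis by simp
qed

lemma sum_fun_apply: "(\<Sum>i\<in>A. f i) v = (\<Sum>i\<in>A. f i v)"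
  by (induction A rule: infinite_finite_induct) simp_all

subsection \<open>Counting vectors over GF(2)\<close>

text \<open>The only scalars are 0 and 1, so adjoining \<open>b\<close> outside the span of
  \<open>B\<close> yields the old span together with its translate by \<open>b\<close>. The two are
  disjoint, hence each basis vector doubles the cardinality.\<close>

lemma card_span_independent:
  fixes B :: "('v \<Rightarrow> bit) set"
  assumes "finite B" "gf2.independent B"
  shows "finite (gf2.span B) \<and> card (gf2.span B) = 2 ^ card B"
  using assms
proof induction
  case (insert b B)
  let ?T = "gf2.span B"
  from insert.prems insert.hyps have b: "b \<notin> ?T" and ind: "gf2.independent B"
    by (simp_all add: gf2.independent_insert)
  with insert.IH have IH: "finite ?T" "card ?T = 2 ^ card B" by auto
  have scale: "gf2_scale 0 b = 0" "gf2_scale 1 b = b"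
    by (simp_all add: gf2_scale_def fun_eq_iff)
  have "x \<in> gf2.span (insert b B) \<longleftrightarrow> x \<in> ?T \<or> x - b \<in> ?T" for x
  proof -
    have "x \<in> gf2.span (insert b B) \<longleftrightarrow> (\<exists>k. x - gf2_scale k b \<in> ?T)"
      by (simp add: gf2.span_insert)
    also have "\<dots> \<longleftrightarrow> x - gf2_scale 0 b \<in> ?T \<or> x - gf2_scale 1 b \<in> ?T"
      by (metis bit_not_zero_iff)
    finally show ?thesis by (simp add: scale)
  qed
  moreover have "x - b \<in> ?T \<longleftrightarrow> x \<in> (\<lambda>y. y + b) ` ?T" for x
    by (metis (no_types, lifting) add_diff_cancel diff_add_cancel image_iff)
  ultimately have eq: "gf2.span (insert b B) = ?T \<union> (\<lambda>y. y + b) ` ?T" by blast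
  have "?T \<inter> (\<lambda>y. y + b) ` ?T = {}"
    using b by (auto dest: gf2.span_add_eq)
  then have "card (gf2.span (insert b B)) = card ?T + card ?T"
    unfolding eq using IH(1) by (subst card_Un_disjoint) (auto simp: card_image)
  with IH eq insert.hyps show ?case by simp
qed simp

lemma card_subspace:
  fixes W :: "('v \<Rightarrow> bit) set"
  assumes "finite W" "gf2.subspace W"
  shows "card W = 2 ^ gf2.dim W"
proof -
  obtain B where B: "B \<subseteq> W" "gf2.independent B" "W \<subseteq> gf2.span B" "card B = gf2.dim W"
    by (rule gf2.basis_exists)
  then have "gf2.span B = W"
    using assms(2) gf2.span_minimal by blast
  with B card_span_independent[of B] assms(1) show ?thesis
    using finite_subset by metis
qed

text \<open>Vectors indexed by \<open>S\<close> are extended by 0, so that vectors for different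
  vertex sets share one type.\<close>

definition supported :: "'v set \<Rightarrow> ('v \<Rightarrow> bit) set" where
  "supported S = {f. \<forall>v. v \<notin> S \<longrightarrow> f v = 0}"

text \<open>\<open>M\<close> is not cut down to \<open>S\<close>: one matrix on the whole vertex set
  then serves all induced subgraphs.\<close>

definition matrix_kernel :: "('v \<Rightarrow> 'v \<Rightarrow> bit) \<Rightarrow> 'v set \<Rightarrow> ('v \<Rightarrow> bit) set" where
  "matrix_kernel M S = {f \<in> supported S. \<forall>u\<in>S. (\<Sum>w\<in>S. M u w * f w) = 0}"

lemma bij_betw_supported: "bij_betw (\<lambda>T v. of_bool (v \<in> T)) (Pow S) (supported S)"
  by (rule bij_betw_byWitness[where f' = "\<lambda>f. {v. f v = 1}"])
    (auto simp: supported_def fun_eq_iff)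

lemma
  assumes "finite S"
  shows finite_supported: "finite (supported S)"
    and card_supported: "card (supported S) = 2 ^ card S"
  using bij_betw_supported[of S] assms
  by (auto simp: card_Pow dest: bij_betw_finite bij_betw_same_card)

lemma subspace_supported: "gf2.subspace (supported S)"
  by (auto simp: gf2.subspace_def supported_def gf2_scale_def)

lemma finite_matrix_kernel: "finite S \<Longrightarrow> finite (matrix_kernel M S)"
  by (rule finite_subset[OF _ finite_supported]) (auto simp: matrix_kernel_def)

lemma subspace_matrix_kernel: "gf2.subspace (matrix_kernel M S)"
  by (auto simp: gf2.subspace_def matrix_kernel_def supported_def gf2_scale_def
      ring_distribs sum.distrib mult.left_commute simp flip: sum_distrib_left)

lemma card_matrix_kernel: "finite S \<Longrightarrow> card (matrix_kernel M S) = 2 ^ gf2.dim (matrix_kernel M S)"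
  by (simp add: card_subspace finite_matrix_kernel subspace_matrix_kernel)

lemma matrix_kernel_cong:
  assumes "\<And>u w. u \<in> S \<Longrightarrow> w \<in> S \<Longrightarrow> M u w = M' u w"
  shows "matrix_kernel M S = matrix_kernel M' S"
  using assms by (auto simp: matrix_kernel_def)

lemma graph_kernel_eq: "graph_kernel G = matrix_kernel (adj_matrix G) (verts G)"
  by (auto simp: graph_kernel_def matrix_kernel_def supported_def)

text \<open>The image of the matrix map \<open>L\<close> is the row space, and each fibre over it is
  a translate of the kernel. Counting the domain fibre by fibre writes 2 to the number of vertices
  as 2 to the rank times 2 to the nullity.\<close>

theorem rank_nullity:
  fixes G :: "('v, 'z) looped_graph_scheme"
  assumes "is_graph G"
  shows "graph_rank G + graph_nullity G = card (verts G)"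
proof -
  let ?V = "verts G" and ?M = "adj_matrix G"
  define L where "L = (\<lambda>f u. \<Sum>w\<in>?V. ?M u w * f w)"
  have fin: "finite ?V"
    and out: "u \<notin> ?V \<Longrightarrow> ?M u w = 0" and sym: "?M u w = ?M w u" for u w
    using assms by (auto simp: is_graph_def adj_matrix_def)
  have L_add: "L (f + g) = L f + L g" for f g
    by (simp add: L_def fun_eq_iff ring_distribs sum.distrib)
  have L_diff: "L (f - g) = L f - L g" for f g
    using L_add[of "f - g" g] by simp
  have L_scale: "L (gf2_scale c f) = gf2_scale c (L f)" for c f
    by (simp add: L_def fun_eq_iff gf2_scale_def mult.left_commute sum_distrib_left)
  \<comment> \<open>By symmetry a combination of columns is a combination of rows, and
    \<open>graph_rank\<close> is defined through the rows.\<close>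
  have L_comb: "L f = (\<Sum>w\<in>?V. gf2_scale (f w) (?M w))" for f
    by (auto simp: L_def fun_eq_iff gf2_scale_def sum_fun_apply sym mult.commute)
  have ker: "graph_kernel G = {f \<in> supported ?V. L f = 0}"
    by (auto simp: graph_kernel_eq matrix_kernel_def L_def fun_eq_iff out)
  have img: "L ` supported ?V = gf2.span (?M ` ?V)"
  proof
    show "L ` supported ?V \<subseteq> gf2.span (?M ` ?V)"
      unfolding L_comb by (intro image_subsetI gf2.span_sum gf2.span_scale gf2.span_base imageI)
    have "gf2.subspace (L ` supported ?V)"
      using subspace_supported[of ?V] unfolding gf2.subspace_def
      by (auto simp flip: L_add L_scale)
        (metis L_diff cancel_comm_monoid_add_class.diff_cancel image_eqI)
    moreover have "?M ` ?V \<subseteq> L ` supported ?V"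
    proof clarify
      fix v assume v: "v \<in> ?V"
      have "?M v = L (\<lambda>w. of_bool (w = v))"
        using v fin by (simp add: L_def fun_eq_iff sym[of v] of_bool_def if_distrib cong: if_cong)
      moreover have "(\<lambda>w. of_bool (w = v)) \<in> supported ?V"
        using v by (auto simp: supported_def)
      ultimately show "?M v \<in> L ` supported ?V" by blast
    qed
    ultimately show "gf2.span (?M ` ?V) \<subseteq> L ` supported ?V"
      by (rule gf2.span_minimal[rotated])
  qed
  let ?fibre = "\<lambda>y. {f \<in> supported ?V. L f = y}"
  have fibre: "card (?fibre y) = card (graph_kernel G)" if "y \<in> L ` supported ?V" for y
  proof -
    from that obtain g where g: "g \<in> supported ?V" "L g = y" by blast
    have "bij_betw (\<lambda>f. f + g) (graph_kernel G) (?fibre y)"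
      using g by (intro bij_betw_byWitness[where f' = "\<lambda>f. f - g"])
        (auto simp: ker L_add L_diff gf2.subspace_add gf2.subspace_diff subspace_supported)
    then show ?thesis by (metis bij_betw_same_card)
  qed
  have finS: "finite (supported ?V)" by (rule finite_supported[OF fin])
  have "card (supported ?V) = (\<Sum>y\<in>L ` supported ?V. card (?fibre y))"
    using finS sum.image_gen[of "supported ?V" "\<lambda>_. 1::nat" L] by simp
  also have "\<dots> = card (gf2.span (?M ` ?V)) * card (graph_kernel G)"
    by (simp add: fibre flip: img)
  also have "card (gf2.span (?M ` ?V)) = 2 ^ graph_rank G"
    unfolding graph_rank_def
    by (rule card_subspace[OF _ gf2.subspace_span], subst img[symmetric]) (simp add: finS)
  also have "card (graph_kernel G) = 2 ^ graph_nullity G"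
    by (simp add: graph_nullity_def graph_kernel_eq card_matrix_kernel fin)
  finally show ?thesis
    by (simp add: card_supported fin flip: power_add)
qed

subsection \<open>Kernels under elimination\<close>

lemma fun_upd_supported: "f \<in> supported S \<Longrightarrow> f(a := c) \<in> supported (insert a S)"
  by (auto simp: supported_def)

lemma sum_fun_upd_notin: "a \<notin> S \<Longrightarrow> (\<Sum>w\<in>S. M w * (f(a := c)) w) = (\<Sum>w\<in>S. M w * f w)"
  by (rule sum.cong) auto

text \<open>Since the entry at \<open>(a, a)\<close> is 1, row \<open>a\<close> expresses
  \<open>f a\<close> through the values of \<open>f\<close> on \<open>S\<close>. Substituting this
  into the other rows leaves the Schur complement of that entry, with signs irrelevant in
  characteristic 2.\<close>

lemma card_matrix_kernel_loop:
  assumes "finite S" "a \<notin> S" "M a a = 1"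
  shows "card (matrix_kernel M (insert a S)) =
    card (matrix_kernel (\<lambda>u w. M u w + M u a * M a w) S)"
proof -
  let ?s = "\<lambda>u f. \<Sum>w\<in>S. M u w * f w"
  let ?N = "\<lambda>u w. M u w + M u a * M a w"
  \<comment> \<open>\<open>?r\<close> forgets the coordinate at \<open>a\<close> and
    \<open>?e\<close> recovers it from row \<open>a\<close>; between the two kernels they are
    mutually inverse.\<close>
  let ?r = "\<lambda>f. f(a := 0)" and ?e = "\<lambda>f. f(a := ?s a f)"
  have N: "(\<Sum>w\<in>S. ?N u w * f w) = ?s u f + M u a * ?s a f" for u f
    by (simp add: ring_distribs sum.distrib sum_distrib_left mult.assoc)
  have K: "f \<in> matrix_kernel M (insert a S) \<longleftrightarrow>
      f \<in> supported (insert a S) \<and> f a = ?s a f \<and> (\<forall>u\<in>S. M u a * f a = ?s u f)" for f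
    using assms by (simp add: matrix_kernel_def)
  have K': "f \<in> matrix_kernel ?N S \<longleftrightarrow> f \<in> supported S \<and> (\<forall>u\<in>S. ?s u f = M u a * ?s a f)" for f
    by (simp add: matrix_kernel_def N)
  note upd = sum_fun_upd_notin[OF assms(2)]
  have "\<forall>f\<in>matrix_kernel M (insert a S). ?e (?r f) = f"
    using K by (auto simp: upd fun_eq_iff simp del: fun_upd_apply) (simp add: fun_upd_def)
  moreover have "\<forall>f\<in>matrix_kernel ?N S. ?r (?e f) = f"
    using assms(2) by (auto simp: K' supported_def fun_eq_iff)
  moreover have "?r ` matrix_kernel M (insert a S) \<subseteq> matrix_kernel ?N S"
    by (auto simp: K K' upd supported_def simp del: fun_upd_apply) (auto simp: fun_upd_def)
  moreover have "?e ` matrix_kernel ?N S \<subseteq> matrix_kernel M (insert a S)"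
    by (auto simp: K K' upd fun_upd_supported simp del: fun_upd_apply) (auto simp: fun_upd_def)
  ultimately show ?thesis
    by (rule bij_betw_same_card[OF bij_betw_byWitness])
qed

text \<open>The block on \<open>a, b\<close> is the swap matrix, its own inverse. So row
  \<open>a\<close> determines \<open>f b\<close>, row \<open>b\<close> determines
  \<open>f a\<close>, and the Schur complement pairs column \<open>a\<close> with row
  \<open>b\<close> and column \<open>b\<close> with row \<open>a\<close>.\<close>

lemma card_matrix_kernel_edge:
  assumes "finite S" "a \<notin> S" "b \<notin> S" "a \<noteq> b"
    and "M a a = 0" "M b b = 0" "M a b = 1" "M b a = 1"
  shows "card (matrix_kernel M (insert a (insert b S))) =
    card (matrix_kernel (\<lambda>u w. M u w + M u a * M b w + M u b * M a w) S)"
proof -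
  let ?s = "\<lambda>u f. \<Sum>w\<in>S. M u w * f w"
  let ?N = "\<lambda>u w. M u w + M u a * M b w + M u b * M a w"
  let ?r = "\<lambda>f. f(a := 0, b := 0)" and ?e = "\<lambda>f. f(a := ?s b f, b := ?s a f)"
  have N: "(\<Sum>w\<in>S. ?N u w * f w) = ?s u f + (M u a * ?s b f + M u b * ?s a f)" for u f
    by (simp add: ring_distribs sum.distrib sum_distrib_left mult.assoc add.assoc)
  have K: "f \<in> matrix_kernel M (insert a (insert b S)) \<longleftrightarrow>
      f \<in> supported (insert a (insert b S)) \<and> f b = ?s a f \<and> f a = ?s b f \<and>
      (\<forall>u\<in>S. ?s u f = M u a * f a + M u b * f b)" for f
    using assms by (simp add: matrix_kernel_def flip: add.assoc) (metis)
  have K': "f \<in> matrix_kernel ?N S \<longleftrightarrow>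
      f \<in> supported S \<and> (\<forall>u\<in>S. ?s u f = M u a * ?s b f + M u b * ?s a f)" for f
    by (simp add: matrix_kernel_def N)
  note upd = sum_fun_upd_notin[OF assms(2)] sum_fun_upd_notin[OF assms(3)]
  have "\<forall>f\<in>matrix_kernel M (insert a (insert b S)). ?e (?r f) = f"
    using K assms(4) by (auto simp: upd fun_eq_iff simp del: fun_upd_apply) (auto simp: fun_upd_def)
  moreover have "\<forall>f\<in>matrix_kernel ?N S. ?r (?e f) = f"
    using assms(2,3) by (auto simp: K' supported_def fun_eq_iff)
  moreover have "?r ` matrix_kernel M (insert a (insert b S)) \<subseteq> matrix_kernel ?N S"
    by (auto simp: K K' upd supported_def simp del: fun_upd_apply) (auto simp: fun_upd_def)
  moreover have "?e ` matrix_kernel ?N S \<subseteq> matrix_kernel M (insert a (insert b S))"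
    using assms(4)
    by (auto simp: K K' upd supported_def simp del: fun_upd_apply) (auto simp: fun_upd_def)
  ultimately show ?thesis
    by (rule bij_betw_same_card[OF bij_betw_byWitness])
qed

text \<open>The matrix on the right is the congruent matrix \<open>E M E\<^sup>T\<close> for the elementary matrix \<open>E\<close> that
  adds \<open>c u\<close> times row \<open>a\<close> to each row \<open>u\<close>; the quadratic term vanishes since \<open>M a a = 0\<close>.\<close>

lemma card_matrix_kernel_congruence:
  assumes fin: "finite S" and a: "a \<notin> S" and M: "M a a = 0" and c: "c a = 0"
  shows "card (matrix_kernel M (insert a S)) =
    card (matrix_kernel (\<lambda>u w. M u w + c u * M a w + M u a * c w) (insert a S))"
proof -
  let ?N = "\<lambda>M u w. M u w + c u * M a w + M u a * c w"
  \<comment> \<open>\<open>?h\<close> acts as the inverse transpose of \<open>E\<close>, which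
    carries the kernel of \<open>M\<close> to that of the congruent matrix. Its sum avoids
    \<open>a\<close>, so applying \<open>?h\<close> twice adds the same bit twice.\<close>
  let ?h = "\<lambda>f. f(a := f a + (\<Sum>w\<in>S. c w * f w))"
  note upd = sum_fun_upd_notin[OF a]
  have inv: "?h (?h f) = f" for f :: "'a \<Rightarrow> bit"
    by (simp only: upd) (simp add: fun_eq_iff add.assoc)
  then have inj: "inj_on ?h A" for A
    by (rule inj_on_inverseI[where g = ?h])
  have N: "(\<Sum>w\<in>S. ?N M u w * f w) =
      (\<Sum>w\<in>S. M u w * f w) + c u * (\<Sum>w\<in>S. M a w * f w) + M u a * (\<Sum>w\<in>S. c w * f w)" for M u f
    by (simp add: ring_distribs sum.distrib sum_distrib_left mult.assoc)
  have sub: "?h ` matrix_kernel M (insert a S) \<subseteq> matrix_kernel (?N M) (insert a S)"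
    if "M a a = 0" for M
  proof clarify
    fix f assume f: "f \<in> matrix_kernel M (insert a S)"
    then have f_a: "(\<Sum>w\<in>S. M a w * f w) = 0"
      and f_S: "\<forall>u\<in>S. M u a * f a = (\<Sum>w\<in>S. M u w * f w)"
      and supp: "f \<in> supported (insert a S)"
      using fin a that by (auto simp: matrix_kernel_def)
    have row: "(\<Sum>w\<in>insert a S. ?N M u w * g w) = M u a * g a +
        ((\<Sum>w\<in>S. M u w * g w) + c u * (\<Sum>w\<in>S. M a w * g w) + M u a * (\<Sum>w\<in>S. c w * g w))" for u g
      unfolding N[symmetric] using fin a that c by simp
    \<comment> \<open>In \<open>row\<close>, the correction made by \<open>?h\<close> at
      \<open>a\<close> cancels the last term and \<open>f_a\<close> kills the middle one; row
      \<open>u\<close> of the original system remains.\<close>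
    have "(\<Sum>w\<in>insert a S. ?N M u w * ?h f w) = 0" if "u \<in> insert a S" for u
      unfolding row upd using that f_a f_S \<open>M a a = 0\<close> by (auto simp: ring_distribs)
    moreover have "?h f \<in> supported (insert a S)"
      using supp by (auto simp: supported_def)
    ultimately show "?h f \<in> matrix_kernel (?N M) (insert a S)"
      unfolding matrix_kernel_def by blast
  qed
  have le: "card (matrix_kernel M (insert a S)) \<le> card (matrix_kernel (?N M) (insert a S))"
    if "M a a = 0" for M
    by (rule card_inj_on_le[OF inj sub[of M, OF that]]) (simp add: finite_matrix_kernel fin)
  \<comment> \<open>\<open>?N M\<close> again vanishes at \<open>(a, a)\<close>, so the inequality
    \<open>le\<close> applies to it as well; as \<open>?N\<close> is an involution, this is the
    reverse inequality.\<close>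
  have "?N (?N M) = M"
    using M c by (simp add: fun_eq_iff ac_simps)
  then show ?thesis
    using le[of M, OF M] le[of "?N M"] M c by simp
qed

subsection \<open>Rank and nullity of induced subgraphs\<close>

lemma verts_induced [simp]: "S \<subseteq> verts G \<Longrightarrow> verts (induced G S) = S"
  by (auto simp: induced_def)

lemma is_graph_induced: "is_graph G \<Longrightarrow> is_graph (induced G S)"
  by (auto simp: is_graph_def induced_def)

lemma induced_del_vertex:
  "S \<subseteq> verts G - {a} \<Longrightarrow> induced (del_vertex G a) S = induced G S"
  by (auto simp: del_vertex_def induced_def fun_eq_iff
      intro!: arg_cong2[where f = "\<lambda>V A. G\<lparr>verts := V, adj := A\<rparr>"])

lemma is_graph_local_complement: "is_graph G \<Longrightarrow> is_graph (local_complement G a)"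
  unfolding is_graph_def local_complement_def toggle_def by auto

lemma is_graph_pivot: "is_graph G \<Longrightarrow> is_graph (pivot G a b)"
  unfolding is_graph_def pivot_def pivot_pair_def toggle_def by auto

lemma verts_local_complement [simp]: "verts (local_complement G a) = verts G"
  by (simp add: local_complement_def toggle_def)

lemma verts_pivot [simp]: "verts (pivot G a b) = verts G"
  by (simp add: pivot_def toggle_def)

lemma card_kernel_induced:
  assumes "is_graph G" "S \<subseteq> verts G"
  shows "card (matrix_kernel (adj_matrix G) S) = 2 ^ graph_nullity (induced G S)"
proof -
  have "graph_kernel (induced G S) = matrix_kernel (adj_matrix G) S"
    using assms(2) unfolding graph_kernel_eq
    by (subst verts_induced) (auto intro!: matrix_kernel_cong simp: adj_matrix_def induced_def)
  moreover have "finite S"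
    using assms by (auto simp: is_graph_def intro: finite_subset)
  ultimately show ?thesis
    by (simp add: graph_nullity_def card_matrix_kernel)
qed

lemma rank_nullity_induced:
  assumes "is_graph G" "S \<subseteq> verts G"
  shows "graph_rank (induced G S) + graph_nullity (induced G S) = card S"
  using rank_nullity[OF is_graph_induced[OF assms(1)], of S] assms(2) by simp

text \<open>The part of a summand of \<open>interlace_poly\<close> that depends on adjacency; the
  vertex weights are left to \<open>subset_sum\<close>.\<close>

definition rank_weight ::
  "'a::{comm_ring, comm_monoid_mult} \<Rightarrow> 'a \<Rightarrow> ('v, 'z) looped_graph_scheme \<Rightarrow> 'v set \<Rightarrow> 'a" where
  "rank_weight x y G S =
    (x - 1) ^ graph_rank (induced G S) * (y - 1) ^ graph_nullity (induced G S)"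

text \<open>Equal kernel sizes mean equal nullities, so by rank-nullity the \<open>k\<close>
  additional vertices all count towards the rank. The eliminations use \<open>k\<close> = 1 and 2,
  the congruence \<open>k\<close> = 0.\<close>

lemma rank_weight_shift:
  assumes G: "is_graph G" "S \<subseteq> verts G" and H: "is_graph H" "T \<subseteq> verts H"
    and ker: "card (matrix_kernel (adj_matrix G) S) = card (matrix_kernel (adj_matrix H) T)"
    and card: "card S = k + card T"
  shows "rank_weight x y G S = (x - 1) ^ k * rank_weight x y H T"
proof -
  have null: "graph_nullity (induced G S) = graph_nullity (induced H T)"
    using ker by (simp add: card_kernel_induced G H)
  moreover have "graph_rank (induced G S) = k + graph_rank (induced H T)"
    using rank_nullity_induced[OF G] rank_nullity_induced[OF H] null card by simp
  ultimately show ?thesis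
    by (simp add: rank_weight_def power_add mult.assoc)
qed

text \<open>The correction \<open>M u a * M a w\<close> in the Schur complement is 1 exactly when
  \<open>u\<close> and \<open>w\<close> are both neighbours of \<open>a\<close>, also for
  \<open>u = w\<close>: this is the toggling of the local complement.\<close>

lemma rank_weight_local_complement:
  assumes G: "is_graph G" and a: "adj G a a" and S: "S \<subseteq> verts G - {a}"
  shows "rank_weight x y G (insert a S) = (x - 1) * rank_weight x y (local_complement G a) S"
proof -
  let ?M = "adj_matrix G"
  have "finite S" "a \<notin> S" "insert a S \<subseteq> verts G"
    using G a S by (auto simp: is_graph_def intro: finite_subset)
  moreover have "card (matrix_kernel ?M (insert a S)) =
      card (matrix_kernel (\<lambda>u w. ?M u w + ?M u a * ?M a w) S)"
    using calculation a by (intro card_matrix_kernel_loop) (auto simp: adj_matrix_def)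
  moreover have "matrix_kernel (\<lambda>u w. ?M u w + ?M u a * ?M a w) S =
      matrix_kernel (adj_matrix (local_complement G a)) S"
    using G \<open>a \<notin> S\<close>
    by (intro matrix_kernel_cong)
      (auto simp: adj_matrix_def local_complement_def toggle_def is_graph_def)
  ultimately show ?thesis
    using rank_weight_shift[of G "insert a S" "local_complement G a" S 1] G
    by (simp add: is_graph_local_complement)
qed

text \<open>When both products are 1 they cancel modulo 2; this is the case excluded by the last
  clause of \<open>pivot_pair\<close>. Otherwise each product accounts for one order of the
  unordered pair.\<close>

lemma adj_matrix_pivot:
  assumes "is_graph G" "u \<notin> {a, b}" "w \<notin> {a, b}"
  shows "adj_matrix (pivot G a b) u w =
    adj_matrix G u w + adj_matrix G u a * adj_matrix G b w + adj_matrix G u b * adj_matrix G a w"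
proof -
  have "adj G b w = adj G w b" "adj G a w = adj G w a"
    using assms by (auto simp: is_graph_def)
  then show ?thesis
    using assms(2,3) by (auto simp: adj_matrix_def pivot_def pivot_pair_def toggle_def)
qed

lemma rank_weight_pivot_both:
  assumes G: "is_graph G" and ab: "a \<noteq> b" "adj G a b" "\<not> adj G a a" "\<not> adj G b b"
    and S: "S \<subseteq> verts G - {a} - {b}"
  shows "rank_weight x y G (insert a (insert b S)) = (x - 1)\<^sup>2 * rank_weight x y (pivot G a b) S"
proof -
  let ?M = "adj_matrix G"
  have fin: "finite S" "a \<notin> S" "b \<notin> S" "insert a (insert b S) \<subseteq> verts G" "adj G b a"
    using G ab S by (auto simp: is_graph_def intro: finite_subset)
  moreover have "card (matrix_kernel ?M (insert a (insert b S))) =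
      card (matrix_kernel (\<lambda>u w. ?M u w + ?M u a * ?M b w + ?M u b * ?M a w) S)"
    using fin ab by (intro card_matrix_kernel_edge) (auto simp: adj_matrix_def)
  moreover have "matrix_kernel (\<lambda>u w. ?M u w + ?M u a * ?M b w + ?M u b * ?M a w) S =
      matrix_kernel (adj_matrix (pivot G a b)) S"
    using G fin by (intro matrix_kernel_cong) (subst adj_matrix_pivot; auto)
  ultimately show ?thesis
    using rank_weight_shift[of G "insert a (insert b S)" "pivot G a b" S 2] G ab(1)
    by (simp add: is_graph_pivot)
qed

lemma rank_weight_pivot_one:
  assumes G: "is_graph G" and ab: "a \<noteq> b" "adj G a b" "\<not> adj G a a" "\<not> adj G b b"
    and S: "S \<subseteq> verts G - {a} - {b}"
  shows "rank_weight x y G (insert a S) = rank_weight x y (pivot G a b) (insert a S)"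
proof -
  \<comment> \<open>Row and column \<open>a\<close> are added to those of the neighbours of
    \<open>b\<close>. As \<open>a\<close> is itself such a neighbour, its entry is reset to 0, as
    the congruence requires.\<close>
  let ?M = "adj_matrix G" and ?c = "\<lambda>u. if u = a then 0 else adj_matrix G u b"
  have fin: "finite S" "a \<notin> S" "b \<notin> S" "insert a S \<subseteq> verts G"
    using G ab S by (auto simp: is_graph_def intro: finite_subset)
  moreover have "card (matrix_kernel ?M (insert a S)) =
      card (matrix_kernel (\<lambda>u w. ?M u w + ?c u * ?M a w + ?M u a * ?c w) (insert a S))"
    using fin ab by (intro card_matrix_kernel_congruence) (auto simp: adj_matrix_def)
  moreover have "matrix_kernel (\<lambda>u w. ?M u w + ?c u * ?M a w + ?M u a * ?c w) (insert a S) =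
      matrix_kernel (adj_matrix (pivot G a b)) (insert a S)"
  proof (rule matrix_kernel_cong)
    fix u w assume uw: "u \<in> insert a S" "w \<in> insert a S"
    have sym: "?M u' w' = ?M w' u'" for u' w'
      using G by (auto simp: adj_matrix_def is_graph_def)
    show "?M u w + ?c u * ?M a w + ?M u a * ?c w = adj_matrix (pivot G a b) u w"
    \<comment> \<open>Row and column \<open>a\<close> agree because the pivot toggles nothing there
      and both \<open>?M a a\<close> and \<open>?c a\<close> vanish; elsewhere the formula is that
      of \<open>adj_matrix_pivot\<close>.\<close>
    proof (cases "u = a \<or> w = a")
      case True
      then show ?thesis
        using ab(3) by (auto simp: adj_matrix_def pivot_def pivot_pair_def toggle_def)
    next
      case False
      then show ?thesis
        using G uw fin by (subst adj_matrix_pivot) (auto simp: sym[of w b] add_ac)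
    qed
  qed
  ultimately show ?thesis
    using rank_weight_shift[of G "insert a S" "pivot G a b" "insert a S" 0] G
    by (simp add: is_graph_pivot)
qed

text \<open>The adjacency matrix is diagonal, so its kernel on \<open>S\<close> consists of all
  vectors supported on the unlooped vertices; the looped ones make up the rank.\<close>

lemma rank_weight_edgeless:
  assumes G: "is_graph G" and loops: "\<And>u w. adj G u w \<Longrightarrow> u = w" and S: "S \<subseteq> verts G"
  shows "rank_weight x y G S = (\<Prod>v\<in>S. if adj G v v then x - 1 else y - 1)"
proof -
  have fin: "finite S" using G S by (auto simp: is_graph_def intro: finite_subset)
  let ?L = "{v \<in> S. adj G v v}" and ?U = "{v \<in> S. \<not> adj G v v}"
  have "(\<Sum>w\<in>S. adj_matrix G u w * f w) = of_bool (adj G u u) * f u" if "u \<in> S" for u f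
  proof -
    have "(\<Sum>w\<in>S. adj_matrix G u w * f w) = (\<Sum>w\<in>S. if w = u then of_bool (adj G u u) * f u else 0)"
      using loops by (intro sum.cong) (auto simp: adj_matrix_def)
    then show ?thesis using that fin by simp
  qed
  then have "matrix_kernel (adj_matrix G) S = supported ?U"
    by (auto simp: matrix_kernel_def supported_def)
  then have null: "graph_nullity (induced G S) = card ?U"
    using card_kernel_induced[OF G S] fin by (simp add: card_supported)
  have "card ?L + card ?U = card S"
    using fin by (subst card_Un_disjoint[symmetric]) (auto intro: arg_cong[where f = card])
  with rank_nullity_induced[OF G S] null have "graph_rank (induced G S) = card ?L"
    by simp
  with null show ?thesis
    using fin by (simp add: rank_weight_def prod.If_cases Int_def)
qed

subsection \<open>Weighted sums over subsets\<close>

text \<open>\<open>F\<close> is kept arbitrary so that the weights of single vertices can be split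
  off while \<open>F\<close> turns into \<open>F\<close> after an insertion.\<close>

definition subset_sum ::
  "('v \<Rightarrow> 'a::{comm_ring, comm_monoid_mult}) \<Rightarrow> ('v \<Rightarrow> 'a) \<Rightarrow> 'v set \<Rightarrow> ('v set \<Rightarrow> 'a) \<Rightarrow> 'a" where
  "subset_sum p q A F = (\<Sum>S\<in>Pow A. (\<Prod>v\<in>S. p v) * (\<Prod>v\<in>A - S. q v) * F S)"

lemma subset_sum_cong:
  "(\<And>S. S \<subseteq> A \<Longrightarrow> F S = F' S) \<Longrightarrow> subset_sum p q A F = subset_sum p q A F'"
  by (simp add: subset_sum_def)

lemma subset_sum_scale: "subset_sum p q A (\<lambda>S. c * F S) = c * subset_sum p q A F"
  by (simp add: subset_sum_def sum_distrib_left mult.left_commute)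

lemma subset_sum_insert:
  assumes "finite A" "a \<notin> A"
  shows "subset_sum p q (insert a A) F =
    q a * subset_sum p q A F + p a * subset_sum p q A (\<lambda>S. F (insert a S))"
proof -
  have "(\<Prod>v\<in>insert a A - S. q v) = q a * (\<Prod>v\<in>A - S. q v)"
    and "(\<Prod>v\<in>insert a S. p v) = p a * (\<Prod>v\<in>S. p v)"
    and "insert a A - insert a S = A - S" if "S \<in> Pow A" for S
    using that assms
    by (auto simp: insert_Diff_if finite_subset intro!: prod.insert)
  then show ?thesis
    by (simp add: subset_sum_def sum_Pow_insert assms sum_distrib_left mult.left_commute mult.assoc)
qed

text \<open>This is the expansion of the product on the right: \<open>S\<close> records the factors
  from which the summand \<open>p v * r v\<close> is chosen.\<close>

lemma subset_sum_prod:
  assumes "finite A"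
  shows "subset_sum p q A (\<lambda>S. \<Prod>v\<in>S. r v) = (\<Prod>v\<in>A. p v * r v + q v)"
  using assms
proof induction
  case empty
  then show ?case by (simp add: subset_sum_def)
next
  case (insert a A)
  have "subset_sum p q A (\<lambda>S. \<Prod>v\<in>insert a S. r v) =
      subset_sum p q A (\<lambda>S. r a * (\<Prod>v\<in>S. r v))"
    using insert.hyps by (intro subset_sum_cong prod.insert) (auto intro: finite_subset)
  with insert show ?case
    by (simp add: subset_sum_insert subset_sum_scale ring_distribs mult.assoc add.commute)
qed

lemma interlace_poly_eq:
  "interlace_poly x y G = subset_sum (alpha G) (beta G) (verts G) (rank_weight x y G)"
  by (simp add: interlace_poly_def subset_sum_def rank_weight_def mult.assoc)

lemma del_vertex_simps [simp]:
  "verts (del_vertex G a) = verts G - {a}"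
  "alpha (del_vertex H a) = alpha H" "beta (del_vertex H a) = beta H"
  by (auto simp: del_vertex_def induced_def)

lemma rank_weight_del_vertex:
  "S \<subseteq> verts G - {a} \<Longrightarrow> rank_weight x y (del_vertex G a) S = rank_weight x y G S"
  by (simp add: rank_weight_def induced_del_vertex)

text \<open>A set avoiding \<open>a\<close> induces the same subgraph before and after the deletion,
  so only the base set of the sum shrinks.\<close>

lemma interlace_poly_del_vertex:
  "interlace_poly x y (del_vertex G a) =
    subset_sum (alpha G) (beta G) (verts G - {a}) (rank_weight x y G)"
  unfolding interlace_poly_eq del_vertex_simps
  by (intro subset_sum_cong rank_weight_del_vertex)

lemma interlace_poly_del_vertex2:
  "interlace_poly x y (del_vertex (del_vertex G a) b) =
    subset_sum (alpha G) (beta G) (verts G - {a} - {b}) (rank_weight x y G)"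
  unfolding interlace_poly_del_vertex del_vertex_simps
  by (intro subset_sum_cong rank_weight_del_vertex) auto

section \<open>Reduction at a loop, reduction at an edge, and the edgeless case\<close>

theorem theorem1:
  fixes G :: "('v, 'a::{comm_ring, comm_monoid_mult}) weighted_graph" and x y :: 'a
  assumes "is_graph G"
  shows
    "(\<forall>a. adj G a a \<longrightarrow>
        interlace_poly x y G =
          beta G a * interlace_poly x y (del_vertex G a) +
          alpha G a * (x - 1) * interlace_poly x y (del_vertex (local_complement G a) a)) \<and>
     (\<forall>a b. a \<noteq> b \<and> adj G a b \<and> \<not> adj G a a \<and> \<not> adj G b b \<longrightarrow>
        interlace_poly x y G =
          beta G a * interlace_poly x y (del_vertex G a) +
          beta G b * interlace_poly x y (del_vertex (pivot G a b) b) +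
          (alpha G a * alpha G b * (x - 1) ^ 2 - beta G a * beta G b) *
            interlace_poly x y (del_vertex (del_vertex (pivot G a b) a) b)) \<and>
     ((\<forall>u w. adj G u w \<longrightarrow> u = w) \<longrightarrow>
        interlace_poly x y G =
          (\<Prod>v\<in>{v \<in> verts G. \<not> adj G v v}. alpha G v * (y - 1) + beta G v) *
          (\<Prod>v\<in>{v \<in> verts G. adj G v v}. alpha G v * (x - 1) + beta G v))"
proof (intro conjI allI impI)
  let ?V = "verts G"
  let ?P = "subset_sum (alpha G) (beta G)"
  have finV: "finite ?V" and in_V: "adj G u w \<Longrightarrow> u \<in> ?V \<and> w \<in> ?V" for u w
    using assms by (auto simp: is_graph_def)
  have lc_w: "alpha (local_complement G a) = alpha G" "beta (local_complement G a) = beta G" for a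
    by (simp_all add: local_complement_def toggle_def)
  have pivot_w: "alpha (pivot G a b) = alpha G" "beta (pivot G a b) = beta G" for a b
    by (simp_all add: pivot_def toggle_def)
  show "interlace_poly x y G =
      beta G a * interlace_poly x y (del_vertex G a) +
      alpha G a * (x - 1) * interlace_poly x y (del_vertex (local_complement G a) a)"
    if a: "adj G a a" for a
  proof -
    have "insert a (?V - {a}) = ?V" using in_V[OF a] by auto
    then have "?P ?V (rank_weight x y G) = beta G a * ?P (?V - {a}) (rank_weight x y G) +
        alpha G a * ?P (?V - {a}) (\<lambda>S. rank_weight x y G (insert a S))"
      using subset_sum_insert[of "?V - {a}" a] finV by simp
    also have "?P (?V - {a}) (\<lambda>S. rank_weight x y G (insert a S)) =
        ?P (?V - {a}) (\<lambda>S. (x - 1) * rank_weight x y (local_complement G a) S)"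
      by (intro subset_sum_cong rank_weight_local_complement assms a)
    finally show ?thesis
      by (simp only: interlace_poly_eq[of x y G] interlace_poly_del_vertex lc_w
          verts_local_complement subset_sum_scale mult.assoc)
  qed
  show "interlace_poly x y G =
      beta G a * interlace_poly x y (del_vertex G a) +
      beta G b * interlace_poly x y (del_vertex (pivot G a b) b) +
      (alpha G a * alpha G b * (x - 1) ^ 2 - beta G a * beta G b) *
        interlace_poly x y (del_vertex (del_vertex (pivot G a b) a) b)"
    if ab: "a \<noteq> b \<and> adj G a b \<and> \<not> adj G a a \<and> \<not> adj G b b" for a b
  proof -
    let ?W = "?V - {a} - {b}" and ?g = "rank_weight x y G"
      and ?h = "rank_weight x y (pivot G a b)"
    have W: "insert a (?V - {a}) = ?V" "insert b ?W = ?V - {a}" "insert a ?W = ?V - {b}"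
      "finite ?W"
      using in_V[of a b] ab finV by auto
    have "?P ?V ?g = beta G a * ?P (?V - {a}) ?g + alpha G a * ?P (?V - {a}) (\<lambda>S. ?g (insert a S))"
      using subset_sum_insert[of "?V - {a}" a] finV W(1) by simp
    also have "?P (?V - {a}) (\<lambda>S. ?g (insert a S)) =
        beta G b * ?P ?W (\<lambda>S. ?g (insert a S)) +
        alpha G b * ?P ?W (\<lambda>S. ?g (insert a (insert b S)))"
      using subset_sum_insert[of ?W b] W(2,4) by simp
    also have "?P ?W (\<lambda>S. ?g (insert a (insert b S))) = ?P ?W (\<lambda>S. (x - 1)\<^sup>2 * ?h S)"
      using ab by (intro subset_sum_cong rank_weight_pivot_both assms) auto
    also have "?P ?W (\<lambda>S. ?g (insert a S)) = ?P ?W (\<lambda>S. ?h (insert a S))"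
      using ab by (intro subset_sum_cong rank_weight_pivot_one assms) auto
    finally have 1: "?P ?V ?g = beta G a * ?P (?V - {a}) ?g +
        alpha G a * (beta G b * ?P ?W (\<lambda>S. ?h (insert a S)) +
          alpha G b * ((x - 1)\<^sup>2 * ?P ?W ?h))"
      by (simp only: subset_sum_scale)
    \<comment> \<open>Sets with \<open>a\<close> but not \<open>b\<close> enter \<open>1\<close>
      through a sum that is not itself a polynomial of a deletion. Here it is part of the expansion
      of the pivot without \<open>b\<close>; the sets avoiding both vertices are the surplus, which
      the term \<open>- beta G a * beta G b\<close> removes.\<close>
    have 2: "?P (?V - {b}) ?h = beta G a * ?P ?W ?h + alpha G a * ?P ?W (\<lambda>S. ?h (insert a S))"
      using subset_sum_insert[of ?W a] W(3,4) by simp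
    show ?thesis
      unfolding interlace_poly_del_vertex2
      unfolding interlace_poly_eq[of x y G] interlace_poly_del_vertex pivot_w verts_pivot 1 2
      by (simp add: algebra_simps)
  qed
  show "interlace_poly x y G =
      (\<Prod>v\<in>{v \<in> ?V. \<not> adj G v v}. alpha G v * (y - 1) + beta G v) *
      (\<Prod>v\<in>{v \<in> ?V. adj G v v}. alpha G v * (x - 1) + beta G v)"
    if "\<forall>u w. adj G u w \<longrightarrow> u = w"
  proof -
    have "interlace_poly x y G = ?P ?V (\<lambda>S. \<Prod>v\<in>S. if adj G v v then x - 1 else y - 1)"
      unfolding interlace_poly_eq
      using that by (intro subset_sum_cong rank_weight_edgeless assms) auto
    also have "\<dots> = (\<Prod>v\<in>?V. alpha G v * (if adj G v v then x - 1 else y - 1) + beta G v)"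
      by (rule subset_sum_prod[OF finV])
    also have "\<dots> = (\<Prod>v\<in>?V. if adj G v v then alpha G v * (x - 1) + beta G v
        else alpha G v * (y - 1) + beta G v)"
      by (intro prod.cong) auto
    finally show ?thesis
      using finV by (simp add: prod.If_cases Int_def mult.commute)
  qed
qed

end
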